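(* Every well-specified game has a pure-strategy Nash equilibrium. That is: let $I$ be a (possibly infinite) index set with at least two elements, and consider a game with strategy spaces $(S_i)_{i\in I}$ and best-response correspondences $\mathrm{BR}_i\colon S_{-i}\to C(S_i)$, $i\in I$. If the game is well-specified, then there exists a point $s\in S=\prod_{i\in I}S_i$ such that $s_i\in \mathrm{BR}_i(s_{-i})$ for every $i\in I$.
   Context: Hyperspace: for a topological space $X$, $C(X)$ denotes the set of nonempty closed subsets of $X$, equipped with the upper Vietoris topology, which has as a basis the sets $\{K\in C(X)\colon K\subset U\}$ with $U\subset X$ open. Preregular: two points of a topological space are topologically distinguishable if there is an open set containing one but not the other; a space is preregular if any two topologically distinguishable points can be separated by disjoint open neighborhoods. Compact does not include Hausdorff. Game: a family of nonempty topological spaces $(S_i)_{i\in I}$ (strategy spaces), indexed by a possibly infinite set $I$ containing at least two elements, together with, for each $i\in I$, a best-response correspondence, which is a continuous function $\mathrm{BR}_i\colon S_{-i}\to C(S_i)$. Here $S=\prod_{i\in I}S_i$ and $S_{-i}=\prod_{j\neq i}S_j$ carry the product topologies. For $s\in S$, $s_i$ is its $i$th coordinate and $s_{-i}\in S_{-i}$ is $s$ with the $i$th coordinate removed. Pure-strategy Nash equilibrium: a point $s\in S$ with $s_i\in \mathrm{BR}_i(s_{-i})$ for every $i\in I$. Reduction: for $J\subset I$ with at least two elements, let $S_J=\prod_{i\in J}S_i$ and $S_{-J}=\prod_{i\in I\setminus J}S_i$. For a point $p\in S_{-J}$, the reduction around $p$ is the game with index set $J$, strategy spaces $S_i$ ($i\in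 J$), and best-response correspondences $\mathrm{BR}_i(p,\cdot)\colon \prod_{j\in J\setminus\{i\}}S_j\to C(S_i)$ ($i\in J$), i.e. the players outside $J$ have their strategies fixed to be those given by $p$. If $J=I$, the unique corresponding reduction is the original game. A reduction is finite if $J$ is finite. Well-specified: a game is well-specified if (1) each $S_i$ is nonempty, preregular, and compact; (2) each best-response correspondence $\mathrm{BR}_i$ is continuous; and (3) every finite reduction has a pure-strategy Nash equilibrium. The axiom of choice is assumed for this statement. *)

theory Defs
  imports "HOL-Analysis.Analysis"
begin

definition hyperspace :: "'a topology \<Rightarrow> 'a set set" where
  "hyperspace X = {K. closedin X K \<and> K \<noteq> {}}"

definition upper_Vietoris :: "'a topology \<Rightarrow> 'a set topology" where
  "upper_Vietoris X = topology (arbitrary union_of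
     (\<lambda>W. \<exists>U. openin X U \<and> W = {K \<in> hyperspace X. K \<subseteq> U}))"

lemma openin_upper_Vietoris:
  "openin (upper_Vietoris X) = arbitrary union_of
     (\<lambda>W. \<exists>U. openin X U \<and> W = {K \<in> hyperspace X. K \<subseteq> U})"
proof -
  let ?B = "\<lambda>W. \<exists>U. openin X U \<and> W = {K \<in> hyperspace X. K \<subseteq> U}"
  have "?B (W \<inter> W')" if "?B W" "?B W'" for W W'
  proof -
    from that obtain U U' where U: "openin X U" "openin X U'"
      and W: "W = {K \<in> hyperspace X. K \<subseteq> U}" "W' = {K \<in> hyperspace X. K \<subseteq> U'}"
      by blast
    have "W \<inter> W' = {K \<in> hyperspace X. K \<subseteq> U \<inter> U'}"
      using W by blast
    moreover have "openin X (U \<inter> U')"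
      using U by blast
    ultimately show ?thesis
      by blast
  qed
  then have "(arbitrary union_of ?B) (W \<inter> W')" if "?B W" "?B W'" for W W'
    using that by (simp add: arbitrary_union_of_inc)
  then have "istopology (arbitrary union_of ?B)"
    by (subst istopology_base_eq) blast
  then show ?thesis
    unfolding upper_Vietoris_def by (rule topology_inverse')
qed

lemma topspace_upper_Vietoris [simp]: "topspace (upper_Vietoris X) = hyperspace X"
proof
  show "topspace (upper_Vietoris X) \<subseteq> hyperspace X"
    using openin_topspace [of "upper_Vietoris X"]
    unfolding openin_upper_Vietoris union_of_def by blast
  have "{K \<in> hyperspace X. K \<subseteq> topspace X} = hyperspace X"
    by (auto simp: hyperspace_def dest: closedin_subset)
  then have "openin (upper_Vietoris X) (hyperspace X)"
    unfolding openin_upper_Vietoris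
    by (intro arbitrary_union_of_inc) (metis openin_topspace)
  then show "hyperspace X \<subseteq> topspace (upper_Vietoris X)"
    by (rule openin_subset)
qed

definition topologically_distinguishable :: "'a topology \<Rightarrow> 'a \<Rightarrow> 'a \<Rightarrow> bool" where
  "topologically_distinguishable X x y \<longleftrightarrow>
     (\<exists>U. openin X U \<and> (x \<in> U \<and> y \<notin> U \<or> y \<in> U \<and> x \<notin> U))"

definition preregular_space :: "'a topology \<Rightarrow> bool" where
  "preregular_space X \<longleftrightarrow>
     (\<forall>x \<in> topspace X. \<forall>y \<in> topspace X. topologically_distinguishable X x y \<longrightarrow>
        (\<exists>U V. openin X U \<and> openin X V \<and> x \<in> U \<and> y \<in> V \<and> disjnt U V))"

text \<open>
  The strategy spaces are arbitrary topologies whose points lie in one common type. Points of a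
  product over an index set are extensional functions, i.e. equal to \<^const>\<open>undefined\<close> off that set.
  Hence \<open>best_response G i\<close> is meaningful only for \<open>i\<close> in \<open>players G\<close> and on the points of the
  product of the strategy spaces over \<open>players G - {i}\<close>.
\<close>

record ('i, 'a) game =
  players :: "'i set"
  strategies :: "'i \<Rightarrow> 'a topology"
  best_response :: "'i \<Rightarrow> ('i \<Rightarrow> 'a) \<Rightarrow> 'a set"

definition at_least_two :: "'i set \<Rightarrow> bool" where
  "at_least_two A \<longleftrightarrow> (\<exists>i \<in> A. \<exists>j \<in> A. i \<noteq> j)"

definition profiles :: "('i, 'a) game \<Rightarrow> 'i set \<Rightarrow> ('i \<Rightarrow> 'a) topology" where
  "profiles G A = product_topology (strategies G) A"

definition is_game :: "('i, 'a) game \<Rightarrow> bool" where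
  "is_game G \<longleftrightarrow>
     at_least_two (players G) \<and>
     (\<forall>i \<in> players G. topspace (strategies G i) \<noteq> {}) \<and>
     (\<forall>i \<in> players G.
        continuous_map (profiles G (players G - {i})) (upper_Vietoris (strategies G i))
          (best_response G i))"

definition pure_Nash_equilibrium :: "('i, 'a) game \<Rightarrow> ('i \<Rightarrow> 'a) \<Rightarrow> bool" where
  "pure_Nash_equilibrium G s \<longleftrightarrow>
     s \<in> topspace (profiles G (players G)) \<and>
     (\<forall>i \<in> players G. s i \<in> best_response G i (restrict s (players G - {i})))"

text \<open>The players outside \<open>J\<close> play \<open>p\<close>, a point of \<open>profiles G (players G - J)\<close>.\<close>

definition reduction :: "('i, 'a) game \<Rightarrow> 'i set \<Rightarrow> ('i \<Rightarrow> 'a) \<Rightarrow> ('i, 'a) game" where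
  "reduction G J p =
     \<lparr>players = J,
      strategies = strategies G,
      best_response = (\<lambda>i t. best_response G i
        (\<lambda>j \<in> players G - {i}. if j \<in> J then t j else p j))\<rparr>"

lemma is_game_reduction:
  assumes G: "is_game G" and J: "J \<subseteq> players G" "at_least_two J"
    and p: "p \<in> topspace (profiles G (players G - J))"
  shows "is_game (reduction G J p)"
proof -
  have "continuous_map (profiles G (J - {i})) (upper_Vietoris (strategies G i))
      (best_response (reduction G J p) i)" if i: "i \<in> J" for i
  proof -
    have "continuous_map (profiles G (J - {i})) (profiles G (players G - {i}))
        (\<lambda>t. \<lambda>j \<in> players G - {i}. if j \<in> J then t j else p j)"
      unfolding profiles_def continuous_map_componentwise
    proof (intro conjI ballI)
      fix k assume k: "k \<in> players G - {i}"
      show "continuous_map (product_topology (strategies G) (J - {i})) (strategies G k)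
          (\<lambda>t. (\<lambda>j \<in> players G - {i}. if j \<in> J then t j else p j) k)"
      proof (cases "k \<in> J")
        case True
        with k show ?thesis
          using continuous_map_product_projection [of k "J - {i}" "strategies G"] by simp
      next
        case False
        with k p show ?thesis
          by (auto simp: profiles_def PiE_iff)
      qed
    qed auto
    moreover have "continuous_map (profiles G (players G - {i}))
        (upper_Vietoris (strategies G i)) (best_response G i)"
      using G J i unfolding is_game_def by blast
    ultimately show ?thesis
      by (auto simp: reduction_def o_def dest: continuous_map_compose)
  qed
  moreover have "profiles (reduction G J p) = profiles G"
    by (simp add: profiles_def reduction_def fun_eq_iff)
  ultimately show ?thesis
    using G J unfolding is_game_def by (auto simp: reduction_def)
qed

lemma pure_Nash_equilibrium_reduction_players:
  "pure_Nash_equilibrium (reduction G (players G) p) s \<longleftrightarrow> pure_Nash_equilibrium G s"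
proof -
  have "(\<lambda>j \<in> players G - {i}. if j \<in> players G then restrict s (players G - {i}) j else p j)
      = restrict s (players G - {i})" for i
    by auto
  then show ?thesis
    by (simp add: pure_Nash_equilibrium_def reduction_def profiles_def)
qed

definition well_specified :: "('i, 'a) game \<Rightarrow> bool" where
  "well_specified G \<longleftrightarrow>
     (\<forall>i \<in> players G. topspace (strategies G i) \<noteq> {} \<and>
        preregular_space (strategies G i) \<and> compact_space (strategies G i)) \<and>
     (\<forall>i \<in> players G.
        continuous_map (profiles G (players G - {i})) (upper_Vietoris (strategies G i))
          (best_response G i)) \<and>
     (\<forall>J p. J \<subseteq> players G \<and> at_least_two J \<and> finite J \<and>
        p \<in> topspace (profiles G (players G - J)) \<longrightarrow>
        (\<exists>s. pure_Nash_equilibrium (reduction G J p) s))"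

end

theory Submission
  imports Defs
begin

text \<open>
  For each player \<open>i\<close>, the set of profiles at which \<open>i\<close> plays a best response is closed, because a
  compact preregular space is regular and an upper semicontinuous closed-valued correspondence into
  a regular space has closed graph. Equilibria of finite reductions show that these sets have the
  finite intersection property, and the space of profiles is compact by Tychonoff's theorem.
\<close>

text \<open>The complement of a closed \<open>C\<close> is open, so it distinguishes a point
  \<open>x\<close> outside \<open>C\<close> from every \<open>y\<close> in \<open>C\<close>, and
  preregularity then separates each such pair. Since \<open>C\<close> is compact, finitely many of
  the \<open>V y\<close> cover it, and the matching \<open>U y\<close> are intersected.\<close>

lemma compact_preregular_imp_regular_space:
  assumes "compact_space X" and pre: "preregular_space X"
  shows "regular_space X"
  unfolding regular_space_def
proof (intro allI impI, elim conjE)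
  fix C x
  assume C: "closedin X C" and x: "x \<in> topspace X - C"
  have "\<exists>U V. openin X U \<and> openin X V \<and> x \<in> U \<and> y \<in> V \<and> disjnt U V" if y: "y \<in> C" for y
  proof -
    have "openin X (topspace X - C)"
      using C by blast
    then have "topologically_distinguishable X x y"
      using x y unfolding topologically_distinguishable_def by blast
    moreover have "y \<in> topspace X"
      using C y closedin_subset by blast
    ultimately show ?thesis
      using pre x unfolding preregular_space_def by blast
  qed
  then obtain U V where UV: "\<And>y. y \<in> C \<Longrightarrow>
      openin X (U y) \<and> openin X (V y) \<and> x \<in> U y \<and> y \<in> V y \<and> disjnt (U y) (V y)"
    by metis
  have "compactin X C"
    using assms C by (simp add: closedin_compact_space)
  moreover have "Ball (V ` C) (openin X)" "C \<subseteq> \<Union>(V ` C)"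
    using UV by auto
  ultimately obtain \<F> where \<F>: "finite \<F>" "\<F> \<subseteq> V ` C" "C \<subseteq> \<Union>\<F>"
    unfolding compactin_def by meson
  then obtain D where D: "finite D" "D \<subseteq> C" "C \<subseteq> (\<Union>y\<in>D. V y)"
    using finite_subset_image[OF \<F>(1,2)] by blast
  have UV_D: "openin X (U y)" "openin X (V y)" "x \<in> U y" "disjnt (U y) (V y)" if "y \<in> D" for y
    using UV[of y] D(2) that by auto
  \<comment> \<open>If \<open>C\<close> is empty then \<open>D\<close> may be empty and the bare
    intersection would be \<open>UNIV\<close>; meeting it with \<open>topspace X\<close> keeps it
    open.\<close>
  let ?U = "(\<Inter>y\<in>D. U y) \<inter> topspace X"
  have "openin X ?U"
    using D(1) UV_D(1) by (rule openin_INT)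
  moreover have "openin X (\<Union>y\<in>D. V y)"
    using UV_D(2) by blast
  moreover have "x \<in> ?U"
    using UV_D(3) x by blast
  moreover have "disjnt ?U (\<Union>y\<in>D. V y)"
    using UV_D(4) by (fastforce simp: disjnt_iff)
  ultimately show "\<exists>U V. openin X U \<and> openin X V \<and> x \<in> U \<and> C \<subseteq> V \<and> disjnt U V"
    using D(3) by (intro exI[of _ ?U] exI[of _ "\<Union>y\<in>D. V y"] conjI)
qed

text \<open>Upper semicontinuity of \<open>F\<close>: the set is the preimage of a basic open set of
  the hyperspace.\<close>

lemma continuous_map_upper_Vietoris_openin:
  assumes "continuous_map X (upper_Vietoris Y) F" "openin Y V"
  shows "openin X {x \<in> topspace X. F x \<subseteq> V}"
proof -
  have "openin (upper_Vietoris Y) {K \<in> hyperspace Y. K \<subseteq> V}"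
    unfolding openin_upper_Vietoris using assms(2) by (blast intro: arbitrary_union_of_inc)
  then have "openin X {x \<in> topspace X. F x \<in> {K \<in> hyperspace Y. K \<subseteq> V}}"
    using assms(1) openin_continuous_map_preimage by blast
  moreover have "F x \<in> hyperspace Y" if "x \<in> topspace X" for x
    using continuous_map_image_subset_topspace[OF assms(1)] that by auto
  ultimately show ?thesis
    by (simp add: conj_commute cong: conj_cong)
qed

text \<open>The closed graph property, pulled back along \<open>f\<close>. Where \<open>f x\<close>
  lies outside the closed set \<open>F x\<close>, regularity gives disjoint open sets around the
  two; by continuity \<open>f\<close> stays in one and \<open>F\<close> inside the other near
  \<open>x\<close>.\<close>

lemma closedin_coincidence_upper_Vietoris:
  assumes F: "continuous_map X (upper_Vietoris Y) F" and f: "continuous_map X Y f"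
    and reg: "regular_space Y"
  shows "closedin X {x \<in> topspace X. f x \<in> F x}"
proof -
  have "\<exists>T. openin X T \<and> x \<in> T \<and> T \<subseteq> {x \<in> topspace X. f x \<notin> F x}"
    if x: "x \<in> topspace X" "f x \<notin> F x" for x
  proof -
    have "F x \<in> hyperspace Y" "f x \<in> topspace Y"
      using continuous_map_image_subset_topspace[OF F] continuous_map_image_subset_topspace[OF f] x
      by auto
    then have "closedin Y (F x)" "f x \<in> topspace Y - F x"
      using x by (auto simp: hyperspace_def)
    then obtain U V where UV: "openin Y U" "openin Y V" "f x \<in> U" "F x \<subseteq> V" "disjnt U V"
      using reg unfolding regular_space_def by meson
    let ?T = "{x \<in> topspace X. f x \<in> U} \<inter> {x \<in> topspace X. F x \<subseteq> V}"
    have "openin X ?T"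
      using openin_continuous_map_preimage[OF f UV(1)]
        continuous_map_upper_Vietoris_openin[OF F UV(2)] by (rule openin_Int)
    moreover have "x \<in> ?T" "?T \<subseteq> {x \<in> topspace X. f x \<notin> F x}"
      using UV x by (auto simp: disjnt_iff)
    ultimately show ?thesis
      by (intro exI[of _ ?T] conjI)
  qed
  then have "openin X {x \<in> topspace X. f x \<notin> F x}"
    by (subst openin_subopen) simp
  moreover have "topspace X - {x \<in> topspace X. f x \<in> F x} = {x \<in> topspace X. f x \<notin> F x}"
    by blast
  ultimately show ?thesis
    by (simp add: closedin_def)
qed

definition best_responding :: "('i, 'a) game \<Rightarrow> 'i \<Rightarrow> ('i \<Rightarrow> 'a) set" where
  "best_responding G i = {s \<in> topspace (profiles G (players G)).
     s i \<in> best_response G i (restrict s (players G - {i}))}"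

lemma closedin_best_responding:
  assumes G: "well_specified G" and i: "i \<in> players G"
  shows "closedin (profiles G (players G)) (best_responding G i)"
  unfolding best_responding_def
proof (rule closedin_coincidence_upper_Vietoris)
  have "continuous_map (profiles G (players G)) (profiles G (players G - {i}))
      (\<lambda>s. restrict s (players G - {i}))"
    unfolding profiles_def continuous_map_componentwise
    by (auto intro: continuous_map_product_projection)
  then show "continuous_map (profiles G (players G)) (upper_Vietoris (strategies G i))
      (\<lambda>s. best_response G i (restrict s (players G - {i})))"
    using G i continuous_map_compose unfolding well_specified_def o_def by blast
  show "continuous_map (profiles G (players G)) (strategies G i) (\<lambda>s. s i)"
    unfolding profiles_def using i by (rule continuous_map_product_projection)
  show "regular_space (strategies G i)"
    using G i compact_preregular_imp_regular_space unfolding well_specified_def by blast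
qed

lemma finite_best_responding_nonempty:
  assumes G: "is_game G" "well_specified G" and F: "finite F" "F \<subseteq> players G"
  shows "topspace (profiles G (players G)) \<inter> (\<Inter>i\<in>F. best_responding G i) \<noteq> {}"
proof -
  obtain a b where ab: "a \<in> players G" "b \<in> players G" "a \<noteq> b"
    using G(1) unfolding is_game_def at_least_two_def by blast
  \<comment> \<open>Reductions need at least two players, while \<open>F\<close> may have
    fewer.\<close>
  define J where "J = insert a (insert b F)"
  have J: "J \<subseteq> players G" "at_least_two J" "finite J"
    using ab F unfolding J_def at_least_two_def by auto
  have "topspace (profiles G (players G - J)) \<noteq> {}"
    using G(1) by (auto simp: profiles_def is_game_def PiE_eq_empty_iff)
  then obtain p where p: "p \<in> topspace (profiles G (players G - J))"
    by blast
  then obtain s where s: "pure_Nash_equilibrium (reduction G J p) s"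
    using G(2) J unfolding well_specified_def by blast
  \<comment> \<open>Glue the equilibrium of the reduction to the fixed strategies outside
    \<open>J\<close>.\<close>
  define t where "t = (\<lambda>j \<in> players G. if j \<in> J then s j else p j)"
  have t: "t \<in> topspace (profiles G (players G))"
    using s p
    by (auto simp: t_def pure_Nash_equilibrium_def reduction_def profiles_def PiE_iff)
  have "t \<in> best_responding G i" if i: "i \<in> J" for i
  proof -
    \<comment> \<open>For \<open>i\<close> in \<open>J\<close>, the opponents' profile seen in
      \<open>G\<close> at \<open>t\<close> is exactly the one that the reduction feeds to
      \<open>best_response G i\<close> at \<open>s\<close>.\<close>
    have "restrict t (players G - {i})
        = (\<lambda>j \<in> players G - {i}. if j \<in> J then restrict s (J - {i}) j else p j)"
      by (auto simp: t_def fun_eq_iff)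
    moreover have "t i = s i"
      using i J by (auto simp: t_def)
    ultimately show ?thesis
      using s i t by (simp add: best_responding_def pure_Nash_equilibrium_def reduction_def)
  qed
  then show ?thesis
    using t unfolding J_def by blast
qed

theorem theorem4:
  fixes G :: "('i, 'a) game"
  assumes "is_game G"
    and "well_specified G"
  shows "\<exists>s. pure_Nash_equilibrium G s"
proof -
  let ?X = "profiles G (players G)" and ?E = "best_responding G ` players G"
  have "compact_space ?X"
    using assms(2) unfolding profiles_def well_specified_def
    by (simp add: compact_space_product_topology)
  moreover have "closedin ?X C" if "C \<in> ?E" for C
    using that closedin_best_responding[OF assms(2)] by blast
  moreover have "\<Inter>\<F> \<noteq> {}" if \<F>: "finite \<F>" "\<F> \<subseteq> ?E" for \<F>
  proof -
    obtain F where "finite F" "F \<subseteq> players G" "\<F> = best_responding G ` F"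
      using finite_subset_image[OF \<F>] by blast
    then show ?thesis
      using finite_best_responding_nonempty[OF assms, of F] by blast
  qed
  ultimately have "\<Inter>?E \<noteq> {}"
    unfolding compact_space_fip by simp
  then obtain s where s: "\<And>i. i \<in> players G \<Longrightarrow> s \<in> best_responding G i"
    by blast
  \<comment> \<open>That \<open>s\<close> is a profile at all is known only through its membership
    in some \<open>best_responding G i\<close>, so a player must exist.\<close>
  moreover have "players G \<noteq> {}"
    using assms(1) by (auto simp: is_game_def at_least_two_def)
  ultimately show ?thesis
    unfolding best_responding_def pure_Nash_equilibrium_def by blast
qed

end
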